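(* Let $(K,\nu)$ be a valued field with $K$ algebraically closed, and let $\mu$ be a valuation of $K[x]$ extending $\nu$. Then either $\mu=\omega_{(a,\delta)}$ for some $a\in K$ and some $\delta\in\tilde\Gamma$, or $\mu$ is the valuation associated with a pseudo-convergent family $(a_\alpha)_{\alpha\in A}$ of elements of $K$.
   Context: Valuations are written additively. $\tilde\Gamma$ is a fixed totally ordered abelian group containing the value group $\Gamma_\nu$ of $\nu$ and the value groups of all valuations of $K[x]$ under consideration. A valuation of $K[x]$ is the restriction to $K[x]$ of a valuation of $K(x)$ (so only $0$ has infinite value). For $a\in K$ and $\delta\in\tilde\Gamma$, $\omega_{(a,\delta)}$ is the valuation of $K[x]$ defined, for $f=\sum_j c_j(x-a)^j$ with $c_j\in K$, by $\omega_{(a,\delta)}(f)=\min_j(\nu(c_j)+j\delta)$. A family $(a_\alpha)_{\alpha\in A}$ of elements of $K$, indexed by a totally ordered set $A$ without greatest element, is pseudo-convergent if $\nu(a_\tau-a_\sigma)>\nu(a_\sigma-a_\rho)$ for all $\tau>\sigma>\rho$ in $A$. Then $\delta_\alpha:=\nu(a_\beta-a_\alpha)$ does not depend on $\beta>\alpha$. The valuation $\mu$ is said to be associated with the pseudo-convergent family $(a_\alpha)_{\alpha\in A}$ if for every $f\in K[x]$ the family $(\omega_{(a_\alpha,\delta_\alpha)}(f))_{\alpha\in A}$ (which is nondecreasing in $\alpha$) has a greatest element and $\mu(f)$ is equal to this greatest element. *)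

theory Defs
  imports
    "HOL-Library.Lattice_Constructions"
    "HOL-Computational_Algebra.Computational_Algebra"
begin

hide_const (open) flat_complete_lattice.Value flat_complete_lattice.Top

text \<open>
  Valuations are written additively and take values in \<open>'g top\<close>, i.e. in the totally ordered
  abelian group \<open>'g\<close> (playing the role of the fixed ambient value group) together with an
  additional greatest element \<open>Top\<close> (infinity), which is absorbing for addition.
\<close>

instantiation top :: (plus) plus
begin

definition plus_top :: "'a top \<Rightarrow> 'a top \<Rightarrow> 'a top" where
  "plus_top x y = (case (x, y) of (Value a, Value b) \<Rightarrow> Value (a + b) | _ \<Rightarrow> Top)"

instance ..

end

lemma plus_top_simps [simp]:
  "Value a + Value b = Value (a + b)"
  "Top + y = Top"
  "x + Top = Top"
  by (auto simp: plus_top_def split: top.splits)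

definition valuation :: "('r :: idom \<Rightarrow> 'g :: linordered_ab_group_add top) \<Rightarrow> bool" where
  "valuation v \<longleftrightarrow>
     (\<forall>x. v x = Top \<longleftrightarrow> x = 0) \<and>
     (\<forall>x y. v (x * y) = v x + v y) \<and>
     (\<forall>x y. min (v x) (v y) \<le> v (x + y))"

definition poly_valuation :: "('k :: field poly \<Rightarrow> 'g :: linordered_ab_group_add top) \<Rightarrow> bool" where
  "poly_valuation \<mu> \<longleftrightarrow>
     (\<exists>w :: 'k poly fract \<Rightarrow> 'g top. valuation w \<and> (\<forall>f. \<mu> f = w (to_fract f)))"

definition extends_valuation ::
    "('k :: field poly \<Rightarrow> 'g :: linordered_ab_group_add top) \<Rightarrow> ('k \<Rightarrow> 'g top) \<Rightarrow> bool" where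
  "extends_valuation \<mu> \<nu> \<longleftrightarrow> (\<forall>c. \<mu> [:c:] = \<nu> c)"

text \<open>
  The coefficients \<open>c\<^sub>j\<close> of the expansion of \<open>f\<close> in powers of \<open>x - a\<close> are the ordinary coefficients
  of \<open>f(x + a)\<close>; see \<open>shifted_coeffs_expansion\<close>. The multiple \<open>j \<delta>\<close> is written as the
  \<open>j\<close>-fold sum of \<open>\<delta>\<close>.
\<close>

definition shifted_coeffs :: "'k :: field \<Rightarrow> 'k poly \<Rightarrow> nat \<Rightarrow> 'k" where
  "shifted_coeffs a f = coeff (pcompose f [:a, 1:])"

lemma shifted_coeffs_expansion:
  "f = (\<Sum>j\<le>degree f. smult (shifted_coeffs a f j) ([:- a, 1:] ^ j))"
proof -
  define g where "g = pcompose f [:a, 1:]"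
  have deg: "degree g = degree f"
    by (simp add: g_def degree_pcompose)
  have "f = pcompose g [:- a, 1:]"
    by (simp add: g_def pcompose_assoc [symmetric] pcompose_pCons)
  also have "\<dots> = (\<Sum>j\<le>degree g. smult (coeff g j) ([:- a, 1:] ^ j))"
    by (simp add: pcompose_altdef poly_altdef degree_map_poly coeff_map_poly)
  finally show ?thesis
    unfolding deg by (simp add: g_def shifted_coeffs_def)
qed

definition omega ::
    "('k :: field \<Rightarrow> 'g :: linordered_ab_group_add top) \<Rightarrow> 'k \<Rightarrow> 'g \<Rightarrow> 'k poly \<Rightarrow> 'g top" where
  "omega \<nu> a \<delta> f =
     Min ((\<lambda>j. \<nu> (shifted_coeffs a f j) + Value (\<Sum>i<j. \<delta>)) ` {..degree f})"

text \<open>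
  Families are functions on a subset \<open>A\<close> of a linearly ordered type of indices, with \<open>A\<close> carrying
  the induced order.
\<close>

definition pseudo_convergent ::
    "('k :: field \<Rightarrow> 'g :: linordered_ab_group_add top) \<Rightarrow> 'i :: linorder set \<Rightarrow> ('i \<Rightarrow> 'k) \<Rightarrow> bool" where
  "pseudo_convergent \<nu> A a \<longleftrightarrow>
     (\<forall>\<alpha>\<in>A. \<exists>\<beta>\<in>A. \<alpha> < \<beta>) \<and>
     (\<forall>\<rho>\<in>A. \<forall>\<sigma>\<in>A. \<forall>\<tau>\<in>A. \<rho> < \<sigma> \<longrightarrow> \<sigma> < \<tau> \<longrightarrow> \<nu> (a \<sigma> - a \<rho>) < \<nu> (a \<tau> - a \<sigma>))"

definition pc_delta ::
    "('k :: field \<Rightarrow> 'g :: linordered_ab_group_add top) \<Rightarrow> 'i :: linorder set \<Rightarrow> ('i \<Rightarrow> 'k) \<Rightarrow> 'i \<Rightarrow> 'g" where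
  "pc_delta \<nu> A a \<alpha> = (THE \<delta>. \<forall>\<beta>\<in>A. \<alpha> < \<beta> \<longrightarrow> \<nu> (a \<beta> - a \<alpha>) = Value \<delta>)"

definition associated_valuation ::
    "('k :: field \<Rightarrow> 'g :: linordered_ab_group_add top) \<Rightarrow> 'i :: linorder set \<Rightarrow> ('i \<Rightarrow> 'k)
      \<Rightarrow> ('k poly \<Rightarrow> 'g top) \<Rightarrow> bool" where
  "associated_valuation \<nu> A a \<mu> \<longleftrightarrow>
     (\<forall>f. (\<exists>\<alpha>\<in>A. \<mu> f = omega \<nu> (a \<alpha>) (pc_delta \<nu> A a \<alpha>) f) \<and>
          (\<forall>\<alpha>\<in>A. omega \<nu> (a \<alpha>) (pc_delta \<nu> A a \<alpha>) f \<le> \<mu> f))"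

lemma less_imp_eq_Value: "x < y \<Longrightarrow> \<exists>c. x = Value (c :: 'g :: linorder)"
  by (cases x; cases y) (auto simp: less_top_def)

lemma valuation_uminus:
  assumes "valuation v"
  shows   "v (- x) = v x"
proof -
  have mult: "v (x * y) = v x + v y" for x y
    using assms by (auto simp: valuation_def)
  have Top: "v x = Top \<longleftrightarrow> x = 0" for x
    using assms by (auto simp: valuation_def)
  obtain c where c: "v (- 1) = Value c"
    using Top[of "- 1"] by (cases "v (- 1)") auto
  obtain d where d: "v 1 = Value d"
    using Top[of 1] by (cases "v 1") auto
  have "d = 0"
    using mult[of 1 1] d by simp
  hence "c + c = 0"
    using mult[of "- 1" "- 1"] c d by simp
  hence "c = 0"
    by simp
  thus ?thesis
    using mult[of "- 1" x] c by (cases "v x") simp_all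
qed

lemma valuation_add_eq:
  assumes "valuation v" "v x < v y"
  shows   "v (x + y) = v x"
proof (rule antisym)
  have add: "min (v x) (v y) \<le> v (x + y)" for x y
    using assms by (auto simp: valuation_def)
  show "v x \<le> v (x + y)"
    using add[of x y] assms(2) by (simp add: min_def split: if_splits)
  show "v (x + y) \<le> v x"
    using add[of "x + y" "- y"] assms(2) valuation_uminus[OF assms(1), of y]
    by (simp add: min_def split: if_splits)
qed

lemma pc_delta:
  assumes "valuation \<nu>" "pseudo_convergent \<nu> A a" "\<alpha> \<in> A" "\<beta> \<in> A" "\<alpha> < \<beta>"
  shows   "\<nu> (a \<beta> - a \<alpha>) = Value (pc_delta \<nu> A a \<alpha>)"
proof -
  have nogr: "\<exists>\<beta>\<in>A. \<alpha> < \<beta>" if "\<alpha> \<in> A" for \<alpha>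
    using assms that by (auto simp: pseudo_convergent_def)
  have pc: "\<nu> (a \<sigma> - a \<rho>) < \<nu> (a \<tau> - a \<sigma>)"
    if "\<rho> \<in> A" "\<sigma> \<in> A" "\<tau> \<in> A" "\<rho> < \<sigma>" "\<sigma> < \<tau>" for \<rho> \<sigma> \<tau>
    using assms that by (auto simp: pseudo_convergent_def)
  have eq: "\<nu> (a \<tau> - a \<alpha>) = \<nu> (a \<sigma> - a \<alpha>)" if "\<sigma> \<in> A" "\<tau> \<in> A" "\<alpha> < \<sigma>" "\<sigma> < \<tau>" for \<sigma> \<tau>
    using valuation_add_eq[OF assms(1) pc[OF \<open>\<alpha> \<in> A\<close> that]] by simp
  have eq': "\<nu> (a \<tau> - a \<alpha>) = \<nu> (a \<beta> - a \<alpha>)" if "\<tau> \<in> A" "\<alpha> < \<tau>" for \<tau>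
    using eq[of \<tau> \<beta>] eq[of \<beta> \<tau>] that assms by (cases \<tau> \<beta> rule: linorder_cases) auto
  obtain \<gamma> where "\<gamma> \<in> A" "\<beta> < \<gamma>"
    using nogr assms by blast
  then obtain d where d: "\<nu> (a \<beta> - a \<alpha>) = Value d"
    using pc[of \<alpha> \<beta> \<gamma>] assms less_imp_eq_Value by metis
  have "pc_delta \<nu> A a \<alpha> = d"
    unfolding pc_delta_def
  proof (rule the_equality)
    show "\<forall>\<beta>\<in>A. \<alpha> < \<beta> \<longrightarrow> \<nu> (a \<beta> - a \<alpha>) = Value d"
      using d eq' by metis
    show "d' = d" if d': "\<forall>\<beta>\<in>A. \<alpha> < \<beta> \<longrightarrow> \<nu> (a \<beta> - a \<alpha>) = Value d'" for d'
    proof -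
      have "Value d' = Value d"
        using d' d assms(4,5) by metis
      thus ?thesis
        by simp
    qed
  qed
  thus ?thesis
    using d by simp
qed

text \<open>
  Since \<open>\<delta>\<^sub>\<alpha>\<close> is strictly increasing in \<open>\<alpha>\<close>, any pseudo-convergent family can be relabelled by the
  \<open>\<delta>\<^sub>\<alpha>\<close>. So asserting the existence of a family indexed by a subset of \<open>'g\<close> is the same as
  asserting it for an arbitrary totally ordered index set.
\<close>

lemma associated_valuation_reindex:
  fixes A :: "'i :: linorder set" and \<nu> :: "'k :: field \<Rightarrow> 'g :: linordered_ab_group_add top"
  assumes \<nu>: "valuation \<nu>" and pc: "pseudo_convergent \<nu> A a" and \<mu>: "associated_valuation \<nu> A a \<mu>"
  shows   "\<exists>(B :: 'g set) b. pseudo_convergent \<nu> B b \<and> associated_valuation \<nu> B b \<mu>"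
proof -
  define D where "D = pc_delta \<nu> A a"
  define B where "B = D ` A"
  define b where "b = a \<circ> inv_into A D"
  have nogr: "\<exists>\<beta>\<in>A. \<alpha> < \<beta>" if "\<alpha> \<in> A" for \<alpha>
    using pc that by (auto simp: pseudo_convergent_def)
  have pc': "\<nu> (a \<sigma> - a \<rho>) < \<nu> (a \<tau> - a \<sigma>)"
    if "\<rho> \<in> A" "\<sigma> \<in> A" "\<tau> \<in> A" "\<rho> < \<sigma>" "\<sigma> < \<tau>" for \<rho> \<sigma> \<tau>
    using pc that by (auto simp: pseudo_convergent_def)
  have D: "\<nu> (a \<beta> - a \<alpha>) = Value (D \<alpha>)" if "\<alpha> \<in> A" "\<beta> \<in> A" "\<alpha> < \<beta>" for \<alpha> \<beta>
    using pc_delta[OF \<nu> pc that] by (simp add: D_def)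
  have mono: "D \<alpha> < D \<beta>" if \<alpha>\<beta>: "\<alpha> \<in> A" "\<beta> \<in> A" "\<alpha> < \<beta>" for \<alpha> \<beta>
  proof -
    obtain \<gamma> where \<gamma>: "\<gamma> \<in> A" "\<beta> < \<gamma>"
      using nogr[OF \<alpha>\<beta>(2)] by blast
    thus ?thesis
      using pc'[of \<alpha> \<beta> \<gamma>] D[of \<alpha> \<beta>] D[of \<beta> \<gamma>] \<alpha>\<beta> by (simp add: less_top_def)
  qed
  have iff: "D \<alpha> < D \<beta> \<longleftrightarrow> \<alpha> < \<beta>" if "\<alpha> \<in> A" "\<beta> \<in> A" for \<alpha> \<beta>
    using mono[of \<alpha> \<beta>] mono[of \<beta> \<alpha>] that by (cases \<alpha> \<beta> rule: linorder_cases) auto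
  have inj: "inj_on D A"
    by (intro inj_onI) (metis iff less_irrefl linorder_cases)
  have b: "b (D \<alpha>) = a \<alpha>" if "\<alpha> \<in> A" for \<alpha>
    using that inj by (simp add: b_def)
  have pcB: "pseudo_convergent \<nu> B b"
    using nogr pc' by (auto simp: pseudo_convergent_def B_def b iff)
  have DB: "pc_delta \<nu> B b (D \<alpha>) = D \<alpha>" if \<alpha>: "\<alpha> \<in> A" for \<alpha>
  proof -
    obtain \<beta> where \<beta>: "\<beta> \<in> A" "\<alpha> < \<beta>"
      using nogr[OF \<alpha>] by blast
    thus ?thesis
      using pc_delta[OF \<nu> pcB, of "D \<alpha>" "D \<beta>"] D[of \<alpha> \<beta>] \<alpha> by (simp add: B_def b iff)
  qed
  have "associated_valuation \<nu> B b \<mu>"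
    using \<mu> by (simp add: associated_valuation_def B_def b DB[unfolded B_def] flip: D_def)
  with pcB show ?thesis
    by blast
qed

end

theory Submission
  imports Defs
begin

text \<open>
  Write \<open>d b\<close> for the value \<open>\<mu> (x - b)\<close>, a finite element of the value group. For every centre
  \<open>a\<close>, the ultrametric inequality gives \<open>\<omega> (x - b) = min (\<nu> (a - b)) (d a) \<le> d b\<close>, where
  \<open>\<omega>\<close> is the valuation with centre \<open>a\<close> and radius \<open>d a\<close>; and this is an equality as soon as
  \<open>d b \<le> d a\<close>. Now \<open>\<omega>\<close> and \<open>\<mu>\<close> agree on constants and both are additive on multiplication by a
  linear factor (\<open>omega_mult_linear\<close>, a case of the Gauss lemma), and over an algebraically
  closed field every polynomial is a product of linear factors. So \<open>\<omega> \<le> \<mu>\<close> everywhere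
  (\<open>omega_le\<close>), and \<open>\<omega> f = \<mu> f\<close> whenever \<open>d a\<close> bounds \<open>d b\<close> for all roots \<open>b\<close> of \<open>f\<close>
  (\<open>omega_eq\<close>).

  The dichotomy is whether \<open>d\<close> attains a maximum. If it does so at \<open>a\<close>, then \<open>\<mu>\<close> is the
  valuation with centre \<open>a\<close> and radius \<open>d a\<close>. If it does not, choose for each \<open>\<gamma>\<close> in the
  range of \<open>d\<close> some \<open>a \<gamma>\<close> with \<open>d (a \<gamma>) = \<gamma>\<close>. The range has no greatest element, and
  \<open>\<nu> (a \<tau> - a \<sigma>) = \<sigma>\<close> for \<open>\<sigma> < \<tau>\<close>, so this family, indexed by its own radii, is
  pseudo-convergent. As a polynomial has finitely many roots, some member of the family
  dominates all of them, and there the value \<open>\<mu> f\<close> is attained.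
\<close>

section \<open>Addition of values\<close>

instance top :: (ab_semigroup_add) ab_semigroup_add
proof
  fix x y z :: "'a top"
  show "x + y + z = x + (y + z)"
    by (cases x; cases y; cases z) (simp_all add: add.assoc)
  show "x + y = y + x"
    by (cases x; cases y) (simp_all add: add.commute)
qed

instance top :: (ordered_ab_semigroup_add) ordered_ab_semigroup_add
proof
  fix x y z :: "'a top"
  assume "x \<le> y"
  thus "z + x \<le> z + y"
    by (cases x; cases y; cases z) (simp_all add: add_left_mono)
qed

lemma Value_add_zero_right [simp]: "x + Value (0 :: 'g :: monoid_add) = x"
  by (cases x) simp_all

text \<open>
  An infinite \<open>u\<close> would make both sums infinite; finiteness of \<open>u\<close> is what keeps the inequality
  strict.
\<close>
lemma add_less_le_mono_top:
  fixes x y u v :: "'g :: linordered_ab_group_add top"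
  assumes "x < y" "u \<le> v" "u \<noteq> Top"
  shows   "x + u < y + v"
  using assms by (cases x; cases y; cases u; cases v) (auto simp: add_less_le_mono less_top_def)

section \<open>Valuations of polynomials with a centre and a radius\<close>

text \<open>
  The minimum defining the valuation may be taken over all indices: beyond the degree the
  coefficients vanish and contribute infinite terms.
\<close>
lemma omega_le_term:
  assumes "valuation \<nu>"
  shows   "omega \<nu> a \<delta> f \<le> \<nu> (shifted_coeffs a f j) + Value (\<Sum>i<j. \<delta>)"
proof (cases "j \<le> degree f")
  case True
  thus ?thesis
    unfolding omega_def by (intro Min_le) auto
next
  case False
  hence "shifted_coeffs a f j = 0"
    by (simp add: shifted_coeffs_def coeff_eq_0 degree_pcompose)
  hence "\<nu> (shifted_coeffs a f j) = Top"
    using assms by (simp add: valuation_def)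
  thus ?thesis
    by (simp add: less_eq_top_def)
qed

lemma omega_attained:
  "\<exists>j. omega \<nu> a \<delta> f = \<nu> (shifted_coeffs a f j) + Value (\<Sum>i<j. \<delta>)"
proof -
  have "omega \<nu> a \<delta> f \<in> (\<lambda>j. \<nu> (shifted_coeffs a f j) + Value (\<Sum>i<j. \<delta>)) ` {..degree f}"
    unfolding omega_def by (intro Min_in) auto
  thus ?thesis
    by blast
qed

lemma omega_const: "omega \<nu> a \<delta> [:c:] = \<nu> c"
  by (simp add: omega_def shifted_coeffs_def)

lemma shifted_coeffs_mult_linear:
  "shifted_coeffs a ([:- b, 1:] * f) j =
     (a - b) * shifted_coeffs a f j + (case j of 0 \<Rightarrow> 0 | Suc i \<Rightarrow> shifted_coeffs a f i)"
proof -
  have "pcompose ([:- b, 1:] * f) [:a, 1:] = [:a - b, 1:] * pcompose f [:a, 1:]"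
    by (simp only: pcompose_mult) (simp add: pcompose_pCons)
  thus ?thesis
    by (simp add: shifted_coeffs_def coeff_pCons split: nat.splits)
qed

text \<open>
  Multiplying by \<open>x - b\<close> replaces the \<open>j\<close>-th coefficient \<open>c\<^sub>j\<close> of the expansion at \<open>a\<close> by
  \<open>(a - b) c\<^sub>j + c\<^sub>j\<^sub>-\<^sub>1\<close>, which gives one inequality at once. For the other one, an index must be
  found at which the two summands do not cancel. If \<open>\<nu> (a - b) \<le> \<delta>\<close>, the first summand
  dominates at the least index where the minimum for \<open>f\<close> is attained; if \<open>\<delta> < \<nu> (a - b)\<close>, the
  second one dominates just after any index where it is attained.
\<close>
lemma omega_mult_linear:
  fixes \<nu> :: "'k :: field \<Rightarrow> 'g :: linordered_ab_group_add top"
  assumes \<nu>: "valuation \<nu>"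
  shows   "omega \<nu> a \<delta> ([:- b, 1:] * f) = min (\<nu> (a - b)) (Value \<delta>) + omega \<nu> a \<delta> f"
proof (cases "f = 0")
  case True
  have "\<nu> 0 = Top"
    using \<nu> by (simp add: valuation_def)
  thus ?thesis
    using True omega_const[of \<nu> a \<delta> 0] by simp
next
  case False
  define c where "c = shifted_coeffs a f"
  define t where "t j = \<nu> (c j) + Value (\<Sum>i<j. \<delta>)" for j
  define W where "W = omega \<nu> a \<delta> f"
  define e where "e = shifted_coeffs a ([:- b, 1:] * f)"
  define s where "s j = \<nu> (e j) + Value (\<Sum>i<j. \<delta>)" for j
  define V where "V = omega \<nu> a \<delta> ([:- b, 1:] * f)"
  have mult: "\<nu> (x * y) = \<nu> x + \<nu> y" and ultra: "min (\<nu> x) (\<nu> y) \<le> \<nu> (x + y)"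
    and Top: "\<nu> x = Top \<longleftrightarrow> x = 0" for x y
    using \<nu> by (auto simp: valuation_def)
  have W_le: "W \<le> t j" and V_le: "V \<le> s j" for j
    using omega_le_term[OF \<nu>] by (simp_all add: W_def V_def t_def s_def c_def e_def)
  obtain j0 where j0: "W = t j0"
    using omega_attained unfolding W_def t_def c_def by blast
  obtain k where k: "V = s k"
    using omega_attained unfolding V_def s_def e_def by blast
  have e_0: "e 0 = (a - b) * c 0" and e_Suc: "e (Suc i) = (a - b) * c (Suc i) + c i" for i
    by (simp_all add: e_def c_def shifted_coeffs_mult_linear del: mult_pCons_left)
  \<comment> \<open>The values of the two summands of the coefficients of the product, weighted with the
    radius, in terms of those for \<open>f\<close>.\<close>
  have t_first: "\<nu> ((a - b) * c j) + Value (\<Sum>i<j. \<delta>) = \<nu> (a - b) + t j" for j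
    by (simp add: t_def mult add.assoc)
  have t_second: "\<nu> (c i) + Value (\<Sum>i<Suc i. \<delta>) = Value \<delta> + t i" for i
    by (cases "\<nu> (c i)") (simp_all add: t_def ac_simps)
  have W_fin: "W \<noteq> Top"
  proof -
    have "pcompose f [:a, 1:] \<noteq> 0"
      using False by (simp add: pcompose_eq_0_iff)
    then obtain j where "c j \<noteq> 0"
      unfolding c_def shifted_coeffs_def using leading_coeff_0_iff by blast
    hence "t j \<noteq> Top"
      using Top[of "c j"] by (cases "\<nu> (c j)") (simp_all add: t_def)
    thus ?thesis
      using W_le[of j] by (cases "t j") auto
  qed
  have add_min: "min (\<nu> x + z) (\<nu> y + z) \<le> \<nu> (x + y) + z" for x y z
    using ultra[of x y] add_right_mono[of "\<nu> x" "\<nu> (x + y)" z] add_right_mono[of "\<nu> y" "\<nu> (x + y)" z]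
    by (auto simp: min_def split: if_splits)
  have first: "min (\<nu> (a - b)) (Value \<delta>) + W \<le> \<nu> (a - b) + t j"
    and second: "min (\<nu> (a - b)) (Value \<delta>) + W \<le> Value \<delta> + t j" for j
    using W_le by (simp_all add: add_mono)
  have "min (\<nu> (a - b)) (Value \<delta>) + W \<le> s j" for j
  proof (cases j)
    case 0
    thus ?thesis
      using first[of 0] t_first[of 0] by (simp add: s_def e_0)
  next
    case (Suc i)
    have "min (\<nu> (a - b)) (Value \<delta>) + W \<le> \<nu> ((a - b) * c (Suc i)) + Value (\<Sum>i<Suc i. \<delta>)"
      unfolding t_first by (rule first)
    moreover have "min (\<nu> (a - b)) (Value \<delta>) + W \<le> \<nu> (c i) + Value (\<Sum>i<Suc i. \<delta>)"
      unfolding t_second by (rule second)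
    ultimately show ?thesis
      unfolding Suc s_def e_Suc by (intro order_trans[OF min.boundedI add_min])
  qed
  hence ge: "min (\<nu> (a - b)) (Value \<delta>) + W \<le> V"
    by (simp add: k)
  have cancel: "\<nu> x < \<nu> y" if "\<nu> x + Value z < \<nu> y + Value z" for x y z
    using that by (meson add_right_mono leD leI)
  have "V \<le> min (\<nu> (a - b)) (Value \<delta>) + W"
  proof (cases "\<nu> (a - b) \<le> Value \<delta>")
    case True
    define m where "m = (LEAST j. t j = W)"
    have m: "t m = W"
      unfolding m_def using j0 by (intro LeastI[of "\<lambda>j. t j = W"]) simp
    have "s m = \<nu> (a - b) + W"
    proof (cases m)
      case 0
      thus ?thesis
        using t_first[of 0] m by (simp add: s_def e_0)
    next
      case (Suc i)
      have "t i \<noteq> W"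
        using not_less_Least[of i "\<lambda>j. t j = W"] Suc by (auto simp: m_def)
      hence "W < t i"
        using W_le[of i] by auto
      moreover have "\<nu> (a - b) \<noteq> Top"
        using True by auto
      ultimately have "\<nu> (a - b) + t m < Value \<delta> + t i"
        using add_less_le_mono_top[of W "t i" "\<nu> (a - b)" "Value \<delta>"] True m
        by (simp add: add.commute)
      hence "\<nu> ((a - b) * c m) < \<nu> (c i)"
        unfolding t_first[symmetric] t_second[symmetric] Suc by (rule cancel)
      hence "\<nu> (e m) = \<nu> ((a - b) * c m)"
        using valuation_add_eq[OF \<nu>] by (simp add: Suc e_Suc)
      thus ?thesis
        using t_first[of m] m by (simp add: s_def)
    qed
    thus ?thesis
      using V_le[of m] True by (simp add: min_def)
  next
    case False
    have "Value \<delta> + t j0 < \<nu> (a - b) + t (Suc j0)"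
      using add_less_le_mono_top[of "Value \<delta>" "\<nu> (a - b)" W "t (Suc j0)"] False W_le W_fin j0
      by auto
    hence "\<nu> (c j0) < \<nu> ((a - b) * c (Suc j0))"
      unfolding t_first[symmetric] t_second[symmetric] by (rule cancel)
    hence "\<nu> (e (Suc j0)) = \<nu> (c j0)"
      using valuation_add_eq[OF \<nu>] by (simp add: e_Suc add.commute)
    hence "s (Suc j0) = Value \<delta> + W"
      using t_second[of j0] j0 by (simp add: s_def)
    thus ?thesis
      using V_le[of "Suc j0"] False by (simp add: min_def)
  qed
  with ge show ?thesis
    unfolding V_def W_def by (rule antisym[rotated])
qed

section \<open>Comparison with a valuation extending the one of the base field\<close>

lemma valuation_poly_valuation:
  assumes "poly_valuation \<mu>"
  shows   "valuation \<mu>"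
proof -
  obtain w where w: "valuation w" "\<And>f. \<mu> f = w (to_fract f)"
    using assms by (auto simp: poly_valuation_def)
  thus ?thesis
    by (simp add: valuation_def)
qed

lemma linear_factors_induct [case_names const linear]:
  fixes f :: "'k :: alg_closed_field poly"
  assumes const: "\<And>c. P [:c:]"
    and linear: "\<And>b g. P g \<Longrightarrow> P ([:- b, 1:] * g)"
  shows "P f"
proof (induction "degree f" arbitrary: f)
  case 0
  thus ?case
    using const by (metis degree_eq_zeroE)
next
  case (Suc n)
  obtain b where "poly f b = 0"
    using alg_closed_imp_poly_has_root[of f] Suc.hyps(2) by auto
  then obtain g where g: "f = [:- b, 1:] * g"
    using poly_eq_0_iff_dvd by blast
  have "g \<noteq> 0"
    using g Suc.hyps(2) by auto
  hence "degree f = Suc (degree g)"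
    unfolding g by (subst degree_mult_eq) auto
  thus ?case
    using linear[OF Suc.hyps(1)[of g]] Suc.hyps(2) g by simp
qed

context
  fixes \<nu> :: "'k :: alg_closed_field \<Rightarrow> 'g :: linordered_ab_group_add top"
    and \<mu> :: "'k poly \<Rightarrow> 'g top" and d :: "'k \<Rightarrow> 'g"
  assumes \<nu>: "valuation \<nu>" and \<mu>: "valuation \<mu>" and ext: "\<And>c. \<mu> [:c:] = \<nu> c"
    and d: "\<And>b. \<mu> [:- b, 1:] = Value (d b)"
begin

private lemma \<mu>_mult: "\<mu> (f * g) = \<mu> f + \<mu> g"
  using \<mu> by (simp add: valuation_def)

private lemma \<mu>_add: "min (\<mu> f) (\<mu> g) \<le> \<mu> (f + g)"
  using \<mu> by (simp add: valuation_def)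

lemma linear_value_ge: "min (\<nu> (a - b)) (Value (d a)) \<le> Value (d b)"
  using \<mu>_add[of "[:a - b:]" "[:- a, 1:]"] by (simp add: ext d)

text \<open>
  Besides \<open>x - b = (x - a) + (a - b)\<close>, which gives one inequality, the ultrametric inequality is
  applied to \<open>a - b = (x - b) - (x - a)\<close>, which bounds \<open>\<nu> (a - b)\<close> from below by \<open>d b\<close>.
\<close>
lemma linear_value_eq:
  assumes "d b \<le> d a"
  shows   "min (\<nu> (a - b)) (Value (d a)) = Value (d b)"
proof (rule antisym)
  have "min (Value (d b)) (Value (d a)) \<le> \<nu> (a - b)"
    using \<mu>_add[of "[:- b, 1:]" "- [:- a, 1:]"] valuation_uminus[OF \<mu>, of "[:- a, 1:]"]
    by (simp add: ext d)
  thus "Value (d b) \<le> min (\<nu> (a - b)) (Value (d a))"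
    using assms by (simp add: min_def)
qed (rule linear_value_ge)

lemma centre_distance:
  assumes "d b < d a"
  shows   "\<nu> (a - b) = Value (d b)"
  using linear_value_eq[OF less_imp_le[OF assms]]
  by (cases "\<nu> (a - b) \<le> Value (d a)") (use assms in \<open>simp_all add: min_def\<close>)

lemma omega_le: "omega \<nu> a (d a) f \<le> \<mu> f"
proof (induction f rule: linear_factors_induct)
  case (const c)
  show ?case
    by (simp add: omega_const ext)
next
  case (linear b g)
  thus ?case
    unfolding omega_mult_linear[OF \<nu>] \<mu>_mult d by (intro add_mono linear_value_ge)
qed

lemma omega_eq:
  assumes "\<And>b. poly f b = 0 \<Longrightarrow> d b \<le> d a"
  shows   "omega \<nu> a (d a) f = \<mu> f"
  using assms
proof (induction f rule: linear_factors_induct)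
  case (const c)
  show ?case
    by (simp add: omega_const ext)
next
  case (linear b g)
  have "d b \<le> d a" "omega \<nu> a (d a) g = \<mu> g"
    using linear by simp_all
  thus ?case
    unfolding omega_mult_linear[OF \<nu>] \<mu>_mult d by (simp add: linear_value_eq)
qed

text \<open>
  The index set is the range of \<open>d\<close> itself, so that the radius of each member of the family is
  its own index.
\<close>
lemma associated_if_no_max:
  assumes nomax: "\<And>a. \<exists>b. d a < d b"
  shows   "pseudo_convergent \<nu> (range d) (inv d) \<and> associated_valuation \<nu> (range d) (inv d) \<mu>"
proof
  have inv: "d (inv d \<gamma>) = \<gamma>" if "\<gamma> \<in> range d" for \<gamma>
    using that by (rule f_inv_into_f)
  have dist: "\<nu> (inv d \<tau> - inv d \<sigma>) = Value \<sigma>" if "\<sigma> \<in> range d" "\<tau> \<in> range d" "\<sigma> < \<tau>" for \<sigma> \<tau>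
    using centre_distance[of "inv d \<sigma>" "inv d \<tau>"] that inv by simp
  have unbounded: "\<exists>\<tau>\<in>range d. \<sigma> < \<tau>" if "\<sigma> \<in> range d" for \<sigma>
    using nomax that by blast
  show pc: "pseudo_convergent \<nu> (range d) (inv d)"
    unfolding pseudo_convergent_def using unbounded by (auto simp: dist)
  have radius: "pc_delta \<nu> (range d) (inv d) \<gamma> = \<gamma>" if \<gamma>: "\<gamma> \<in> range d" for \<gamma>
  proof -
    obtain \<tau> where "\<tau> \<in> range d" "\<gamma> < \<tau>"
      using unbounded[OF \<gamma>] by blast
    thus ?thesis
      using pc_delta[OF \<nu> pc \<gamma>, of \<tau>] dist[OF \<gamma>, of \<tau>] by simp
  qed
  have le: "omega \<nu> (inv d \<gamma>) \<gamma> f \<le> \<mu> f" if "\<gamma> \<in> range d" for \<gamma> f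
    using omega_le[of "inv d \<gamma>" f] inv[OF that] by simp
  have attained: "\<exists>\<gamma>\<in>range d. \<mu> f = omega \<nu> (inv d \<gamma>) \<gamma> f" for f
  proof (cases "f = 0")
    case True
    thus ?thesis
      using omega_const[of \<nu> _ _ 0] ext[of 0] by auto
  next
    case False
    \<comment> \<open>The extra point \<open>0\<close> only makes the finite set nonempty when \<open>f\<close> is constant.\<close>
    define R where "R = insert 0 {b. poly f b = 0}"
    have R: "finite (d ` R)" "d ` R \<noteq> {}"
      using poly_roots_finite[OF False] by (auto simp: R_def)
    define \<gamma> where "\<gamma> = Max (d ` R)"
    have \<gamma>: "\<gamma> \<in> range d"
      using Max_in[OF R] by (auto simp: \<gamma>_def)
    have "d b \<le> \<gamma>" if "poly f b = 0" for b
      unfolding \<gamma>_def using that by (intro Max_ge R(1)) (simp add: R_def)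
    hence "omega \<nu> (inv d \<gamma>) \<gamma> f = \<mu> f"
      using omega_eq[of f "inv d \<gamma>"] inv[OF \<gamma>] by simp
    thus ?thesis
      using \<gamma> by metis
  qed
  show "associated_valuation \<nu> (range d) (inv d) \<mu>"
    unfolding associated_valuation_def
  proof (intro allI conjI ballI)
    fix f
    show "\<exists>\<gamma>\<in>range d. \<mu> f = omega \<nu> (inv d \<gamma>) (pc_delta \<nu> (range d) (inv d) \<gamma>) f"
      using attained[of f] radius by metis
    show "omega \<nu> (inv d \<gamma>) (pc_delta \<nu> (range d) (inv d) \<gamma>) f \<le> \<mu> f" if "\<gamma> \<in> range d" for \<gamma>
      using le[OF that] radius[OF that] by simp
  qed
qed

end

section \<open>The classification\<close>

theorem proposition2p10:
  fixes \<nu> :: "'k :: alg_closed_field \<Rightarrow> 'g :: linordered_ab_group_add top"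
    and \<mu> :: "'k poly \<Rightarrow> 'g top"
  assumes "valuation \<nu>"
    and "poly_valuation \<mu>"
    and "extends_valuation \<mu> \<nu>"
  shows "(\<exists>(a :: 'k) (\<delta> :: 'g). \<mu> = omega \<nu> a \<delta>) \<or>
         (\<exists>(A :: 'g set) (a :: 'g \<Rightarrow> 'k). pseudo_convergent \<nu> A a \<and> associated_valuation \<nu> A a \<mu>)"
proof -
  have \<mu>: "valuation \<mu>"
    using assms(2) by (rule valuation_poly_valuation)
  have ext: "\<mu> [:c:] = \<nu> c" for c
    using assms(3) by (simp add: extends_valuation_def)
  have "\<exists>e. \<mu> [:- b, 1:] = Value e" for b
    using \<mu> by (cases "\<mu> [:- b, 1:]") (auto simp: valuation_def)
  then obtain d where d: "\<And>b. \<mu> [:- b, 1:] = Value (d b)"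
    by metis
  show ?thesis
  proof (cases "\<exists>a. \<forall>b. d b \<le> d a")
    case True
    then obtain a where "\<And>b. d b \<le> d a"
      by blast
    hence "\<mu> = omega \<nu> a (d a)"
      using omega_eq[OF assms(1) \<mu> ext d, of _ a] by (simp add: fun_eq_iff)
    thus ?thesis
      by blast
  next
    case False
    hence "\<exists>b. d a < d b" for a
      by (meson leI)
    thus ?thesis
      using associated_if_no_max[OF assms(1) \<mu> ext d] by blast
  qed
qed

end
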